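(* Let $\kappa\in\mathbb{R}$ and $E>0$, and let $p$ be the solution of $\ddot p+\sin p=0$ with $p(0)=0$, $\dot p>0$ and energy surplus $E$, i.e. $\frac{\dot p^2}{2}-(1+\cos p)=E$. Let $w$ be a solution of $$\ddot w+(2\kappa+\cos p(t))\,w=0,$$ the linearization around the synchronous solution $x=y=p$ of the coupled pendula system $\ddot x+\sin x=\kappa(y-x)$, $\ddot y+\sin y=\kappa(x-y)$. Then the rescaled function $$W(\tau)=w(k\tau),\qquad k^2=\frac{2}{2+E},\quad k>0,$$ satisfies the Lamé equation corresponding to $n=1$: $$W''+\left[\lambda-2k^2\,\mathrm{sn}^2(\tau,k)\right]W=0,\qquad {}'=\frac{d}{d\tau},$$ with $$\lambda=(2\kappa+1)k^2\quad\text{and}\quad k^2=\frac{2}{2+E}.$$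
   Context: The general Lamé equation is $\ddot W+[\lambda-n(n+1)k^2\,\mathrm{sn}^2(t,k)]W=0$ with $n$ a positive integer. Here $\mathrm{sn}(t,k)$ is Jacobi's elliptic function with modulus $k\in[0,1)$: $\mathrm{sn}(t,k)=\sin x$, where $x$ is defined by $t=\int_0^{x}\frac{d\theta}{\sqrt{1-k^2\sin^2\theta}}$. The equation for $w$ arises from the linearized system with perturbations $\xi,\eta$ of $x,y$ via $w=\xi-\eta$. *)

theory Defs
  imports "HOL-Analysis.Analysis"
begin

text \<open>
  \<open>solves_second_order f u\<close>: \<open>u\<close> is twice differentiable on the whole real line and
  \<open>u''(t) = f t (u t)\<close> for all \<open>t\<close>.
\<close>

definition solves_second_order ::
    "(real \<Rightarrow> 'a \<Rightarrow> 'a) \<Rightarrow> (real \<Rightarrow> 'a::real_normed_vector) \<Rightarrow> bool" where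
  "solves_second_order f u \<longleftrightarrow>
     (\<exists>u'. (\<forall>t. (u has_vector_derivative u' t) (at t)) \<and>
           (\<forall>t. (u' has_vector_derivative f t (u t)) (at t)))"

text \<open>
  The interval integral is oriented, so negative amplitudes are covered. For \<open>\<bar>k\<bar> < 1\<close> the map
  \<open>elliptic_F k\<close> is a bijection of the real line, so the description in \<open>jacobi_am\<close> is proper;
  nothing is intended for other values of \<open>k\<close>.
\<close>

definition elliptic_F :: "real \<Rightarrow> real \<Rightarrow> real" where
  "elliptic_F k x = (LBINT \<theta>=ereal 0..ereal x. 1 / sqrt (1 - k\<^sup>2 * (sin \<theta>)\<^sup>2))"

definition jacobi_am :: "real \<Rightarrow> real \<Rightarrow> real" where
  "jacobi_am t k = (THE x. t = elliptic_F k x)"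

definition jacobi_sn :: "real \<Rightarrow> real \<Rightarrow> real" where
  "jacobi_sn t k = sin (jacobi_am t k)"

definition lame_solution :: "nat \<Rightarrow> real \<Rightarrow> real \<Rightarrow> (real \<Rightarrow> real) \<Rightarrow> bool" where
  "lame_solution n lam k W \<longleftrightarrow>
     solves_second_order
       (\<lambda>t z. - (lam - real n * (real n + 1) * k\<^sup>2 * (jacobi_sn t k)\<^sup>2) * z) W"

definition pendulum_solution :: "(real \<Rightarrow> real) \<Rightarrow> bool" where
  "pendulum_solution p \<longleftrightarrow> solves_second_order (\<lambda>t z. - sin z) p"

definition coupled_force :: "real \<Rightarrow> real \<times> real \<Rightarrow> real \<times> real" where
  "coupled_force \<kappa> = (\<lambda>(x, y). (\<kappa> * (y - x) - sin x, \<kappa> * (x - y) - sin y))"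

definition coupled_pendula_solution ::
    "real \<Rightarrow> (real \<Rightarrow> real) \<Rightarrow> (real \<Rightarrow> real) \<Rightarrow> bool" where
  "coupled_pendula_solution \<kappa> x y \<longleftrightarrow>
     solves_second_order (\<lambda>t. coupled_force \<kappa>) (\<lambda>t. (x t, y t))"

definition linearized_pendula_solution ::
    "real \<Rightarrow> (real \<Rightarrow> real) \<Rightarrow> (real \<Rightarrow> real) \<Rightarrow> (real \<Rightarrow> real) \<Rightarrow> (real \<Rightarrow> real) \<Rightarrow> bool" where
  "linearized_pendula_solution \<kappa> x y \<xi> \<eta> \<longleftrightarrow>
     solves_second_order (\<lambda>t. frechet_derivative (coupled_force \<kappa>) (at (x t, y t)))
       (\<lambda>t. (\<xi> t, \<eta> t))"

definition difference_mode_solution ::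
    "real \<Rightarrow> (real \<Rightarrow> real) \<Rightarrow> (real \<Rightarrow> real) \<Rightarrow> bool" where
  "difference_mode_solution \<kappa> p w \<longleftrightarrow>
     solves_second_order (\<lambda>t z. - (2 * \<kappa> + cos (p t)) * z) w"

end

theory Submission
  imports Defs
begin

text \<open>
  The three conclusions rest on two observations.

  First, the coupling vanishes on the diagonal \<open>x = y\<close>, so everything there is linear algebra:
  the diagonal embedding \<open>z \<mapsto> (z, z)\<close> carries pendulum motions to synchronous motions of the
  coupled system, the functional \<open>(a, b) \<mapsto> a - b\<close> intertwines the linearized force with the scalar
  force \<open>- (2 * \<kappa> + cos p)\<close>, and its right inverse \<open>z \<mapsto> (z / 2, - z / 2)\<close> intertwines them in the
  opposite direction. A continuous linear map that intertwines two forces sends solutions to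
  solutions (\<open>solves_second_order_linear_image\<close>), which settles all these claims.

  Second, the half angle of a rotating pendulum is a Jacobi amplitude. With \<open>k\<^sup>2 = 2 / (2 + E)\<close> the
  half-angle formula turns energy conservation into \<open>(p')\<^sup>2 = (4 / k\<^sup>2) * (1 - k\<^sup>2 * (sin (p / 2))\<^sup>2)\<close>.
  As \<open>p' > 0\<close>, the function \<open>q \<tau> = p (k * \<tau>) / 2\<close> satisfies \<open>q' = sqrt (1 - k\<^sup>2 * (sin q)\<^sup>2)\<close>, which
  says that \<open>elliptic_F k (q \<tau>)\<close> grows at unit rate; hence \<open>q\<close> is the amplitude
  (\<open>jacobi_am_eqI\<close>). So \<open>sn(\<tau>, k) = sin (p (k * \<tau>) / 2)\<close> and
  \<open>cos (p (k * \<tau>)) = 1 - 2 * sn\<^sup>2(\<tau>, k)\<close>. Substituting this into the equation for \<open>w\<close>, with the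
  factor \<open>k\<^sup>2\<close> that rescaling time produces, gives the Lame equation with \<open>n = 1\<close>.
\<close>

section \<open>Transformations of second-order equations\<close>

lemma solves_second_order_linear_image:
  assumes "bounded_linear L"
    and "solves_second_order f u"
    and intertwine: "\<And>t. L (f t (u t)) = g t (L (u t))"
  shows "solves_second_order g (\<lambda>t. L (u t))"
proof -
  obtain u' where u: "\<And>t. (u has_vector_derivative u' t) (at t)"
    and u': "\<And>t. (u' has_vector_derivative f t (u t)) (at t)"
    using assms(2) unfolding solves_second_order_def by blast
  have "((\<lambda>t. L (u t)) has_vector_derivative L (u' t)) (at t)" for t
    by (rule bounded_linear.has_vector_derivative[OF assms(1) u])
  moreover have "((\<lambda>t. L (u' t)) has_vector_derivative g t (L (u t))) (at t)" for t
    using bounded_linear.has_vector_derivative[OF assms(1) u'] by (simp add: intertwine)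
  ultimately show ?thesis
    unfolding solves_second_order_def by (intro exI[of _ "\<lambda>t. L (u' t)"]) blast
qed

lemma has_vector_derivative_rescale:
  fixes u :: "real \<Rightarrow> 'a::real_normed_vector"
  assumes "(u has_vector_derivative u') (at (c * t))"
  shows "((\<lambda>t. u (c * t)) has_vector_derivative c *\<^sub>R u') (at t)"
proof -
  have "((\<lambda>t. c * t) has_vector_derivative c) (at t)"
    by (auto intro!: derivative_eq_intros)
  from vector_diff_chain_at[OF this assms] show ?thesis
    by (simp add: o_def)
qed

lemma solves_second_order_rescale:
  assumes "solves_second_order f u"
  shows "solves_second_order (\<lambda>t z. c\<^sup>2 *\<^sub>R f (c * t) z) (\<lambda>t. u (c * t))"
proof -
  obtain u' where u: "\<And>t. (u has_vector_derivative u' t) (at t)"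
    and u': "\<And>t. (u' has_vector_derivative f t (u t)) (at t)"
    using assms unfolding solves_second_order_def by blast
  have "((\<lambda>t. u (c * t)) has_vector_derivative c *\<^sub>R u' (c * t)) (at t)" for t
    by (rule has_vector_derivative_rescale[OF u])
  moreover have "((\<lambda>t. c *\<^sub>R u' (c * t)) has_vector_derivative
      c\<^sup>2 *\<^sub>R f (c * t) (u (c * t))) (at t)" for t
    using bounded_linear.has_vector_derivative
      [OF bounded_linear_scaleR_right has_vector_derivative_rescale[OF u']]
    by (simp add: power2_eq_square)
  ultimately show ?thesis
    unfolding solves_second_order_def
    by (intro exI[of _ "\<lambda>t. c *\<^sub>R u' (c * t)"]) blast
qed

lemma solves_second_order_cong:
  assumes "solves_second_order f u" and "\<And>t. f t (u t) = g t (u t)"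
  shows "solves_second_order g u"
  using assms unfolding solves_second_order_def by simp

lemma solves_second_order_imp_has_real_derivative:
  assumes "solves_second_order f (u :: real \<Rightarrow> real)"
  shows "(u has_real_derivative deriv u t) (at t)"
proof -
  obtain u' where "(u has_vector_derivative u' t) (at t)"
    using assms unfolding solves_second_order_def by blast
  then have "(u has_real_derivative u' t) (at t)"
    by (simp add: has_real_derivative_iff_has_vector_derivative)
  then show ?thesis
    by (simp add: DERIV_imp_deriv)
qed

section \<open>Jacobi amplitude as the solution of an initial value problem\<close>

lemma elliptic_radicand_pos:
  fixes k x :: real
  assumes "k\<^sup>2 < 1"
  shows "0 < 1 - k\<^sup>2 * (sin x)\<^sup>2"
proof -
  have "k\<^sup>2 * (sin x)\<^sup>2 \<le> k\<^sup>2 * 1"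
    by (intro mult_left_mono) (auto simp: abs_square_le_1)
  with assms show ?thesis by simp
qed

lemma elliptic_F_has_real_derivative:
  assumes "k\<^sup>2 < 1"
  shows "(elliptic_F k has_real_derivative 1 / sqrt (1 - k\<^sup>2 * (sin x)\<^sup>2)) (at x)"
proof -
  define a where "a = min 0 x - 1"
  define b where "b = max 0 x + 1"
  let ?f = "\<lambda>\<theta>. 1 / sqrt (1 - k\<^sup>2 * (sin \<theta>)\<^sup>2)"
  have "continuous_on {a..b} ?f"
    using elliptic_radicand_pos[OF assms] by (intro continuous_intros) (auto simp: less_le)
  then have "((\<lambda>u. LBINT \<theta>=ereal 0..ereal u. ?f \<theta>) has_vector_derivative ?f x)
      (at x within {a..b})"
    by (intro interval_integral_FTC2) (auto simp: a_def b_def)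
  moreover have "at x within {a..b} = at x"
    by (rule at_within_interior) (auto simp: a_def b_def)
  ultimately show ?thesis
    by (simp add: has_real_derivative_iff_has_vector_derivative elliptic_F_def[abs_def])
qed

lemma elliptic_F_0: "elliptic_F k 0 = 0"
  by (simp add: elliptic_F_def)

lemma inj_elliptic_F:
  assumes "k\<^sup>2 < 1"
  shows "inj (elliptic_F k)"
proof -
  have "elliptic_F k x < elliptic_F k y" if "x < y" for x y
    using that
  proof (rule DERIV_pos_imp_increasing)
    fix z
    show "\<exists>d. (elliptic_F k has_real_derivative d) (at z) \<and> 0 < d"
      using elliptic_F_has_real_derivative[OF assms] elliptic_radicand_pos[OF assms]
      by (intro exI[of _ "1 / sqrt (1 - k\<^sup>2 * (sin z)\<^sup>2)"]) auto
  qed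
  then show ?thesis
    by (intro injI) (metis linorder_neq_iff)
qed

text \<open>
  Separation of variables: along a solution \<open>q\<close> the derivative of \<open>elliptic_F k (q t)\<close> is
  identically \<open>1\<close>, so this composition is the identity, and injectivity of \<open>elliptic_F k\<close>
  identifies \<open>q t\<close> as the unique preimage of \<open>t\<close>. The given solution itself witnesses
  that such a preimage exists.
\<close>

lemma jacobi_am_eqI:
  assumes k: "k\<^sup>2 < 1"
    and q: "\<And>t. (q has_real_derivative sqrt (1 - k\<^sup>2 * (sin (q t))\<^sup>2)) (at t)"
    and "q 0 = 0"
  shows "jacobi_am t k = q t"
proof -
  have "((\<lambda>s. elliptic_F k (q s) - s) has_real_derivative 0) (at s)" for s
    using DERIV_diff[OF DERIV_chain2[OF elliptic_F_has_real_derivative[OF k] q] DERIV_ident, of s]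
      elliptic_radicand_pos[OF k, of "q s"] by simp
  then have "elliptic_F k (q t) - t = elliptic_F k (q 0) - 0"
    by (intro DERIV_isconst_all) simp
  then have inverse: "t = elliptic_F k (q t)"
    using \<open>q 0 = 0\<close> by (simp add: elliptic_F_0)
  show ?thesis
    unfolding jacobi_am_def
  proof (rule the_equality[where P = "\<lambda>x. t = elliptic_F k x", OF inverse])
    fix x
    assume "t = elliptic_F k x"
    with inverse show "x = q t"
      using inj_elliptic_F[OF k] by (metis injD)
  qed
qed

section \<open>Rotating pendulum in terms of the elliptic sine\<close>

text \<open>
  The half angle appears because \<open>1 + cos p = 2 - 2 * (sin (p / 2))\<^sup>2\<close> brings the energy integral
  into the Legendre form \<open>1 - k\<^sup>2 * (sin q)\<^sup>2\<close>; the positive square root is the one selected by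
  the direction of rotation.
\<close>

lemma jacobi_am_rotating_pendulum:
  fixes p :: "real \<Rightarrow> real"
  assumes "E > 0"
    and p: "\<And>t. (p has_real_derivative p' t) (at t)"
    and "p 0 = 0"
    and pos: "\<And>t. p' t > 0"
    and energy: "\<And>t. (p' t)\<^sup>2 / 2 - (1 + cos (p t)) = E"
    and "k > 0"
    and k: "k\<^sup>2 = 2 / (2 + E)"
  shows "jacobi_am \<tau> k = p (k * \<tau>) / 2"
proof (rule jacobi_am_eqI)
  show "k\<^sup>2 < 1"
    using \<open>E > 0\<close> by (simp add: k)
  show "p (k * 0) / 2 = 0"
    using \<open>p 0 = 0\<close> by simp
  fix s
  have "(k * p' (k * s) / 2)\<^sup>2 = k\<^sup>2 * ((p' (k * s))\<^sup>2 / 4)"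
    by (simp add: power_mult_distrib power_divide)
  also have "(p' (k * s))\<^sup>2 / 4 = (2 + E) / 2 - (sin (p (k * s) / 2))\<^sup>2"
    using energy[of "k * s"] cos_double_sin[of "p (k * s) / 2"] by (simp add: field_simps)
  also have "k\<^sup>2 * \<dots> = 1 - k\<^sup>2 * (sin (p (k * s) / 2))\<^sup>2"
    using \<open>E > 0\<close> by (simp add: k right_diff_distrib)
  finally have "sqrt (1 - k\<^sup>2 * (sin (p (k * s) / 2))\<^sup>2) = k * p' (k * s) / 2"
    using pos[of "k * s"] \<open>k > 0\<close> by (intro real_sqrt_unique) (auto intro: less_imp_le)
  then show "((\<lambda>s. p (k * s) / 2) has_real_derivative
      sqrt (1 - k\<^sup>2 * (sin (p (k * s) / 2))\<^sup>2)) (at s)"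
    by (auto intro!: derivative_eq_intros DERIV_chain2[OF p])
qed

section \<open>Linearization of the coupled pendula at a synchronous motion\<close>

lemma frechet_derivative_coupled_force:
  "frechet_derivative (coupled_force \<kappa>) (at (x, y)) =
     (\<lambda>(a, b). (\<kappa> * (b - a) - cos x * a, \<kappa> * (a - b) - cos y * b))"
proof -
  have "((\<lambda>z. (\<kappa> * (snd z - fst z) - sin (fst z), \<kappa> * (fst z - snd z) - sin (snd z)))
      has_derivative
      (\<lambda>h. (\<kappa> * (snd h - fst h) - cos x * fst h, \<kappa> * (fst h - snd h) - cos y * snd h)))
      (at (x, y))"
    by (auto intro!: derivative_eq_intros)
  then show ?thesis
    using frechet_derivative_at by (fastforce simp: coupled_force_def case_prod_unfold)
qed

lemma synchronous_coupled_pendula_solution: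
  assumes "pendulum_solution p"
  shows "coupled_pendula_solution \<kappa> p p"
proof -
  have "bounded_linear (\<lambda>z::real. (z, z))"
    by (intro bounded_linear_Pair bounded_linear_ident)
  then show ?thesis
    using assms unfolding coupled_pendula_solution_def pendulum_solution_def
    by (rule solves_second_order_linear_image) (simp add: coupled_force_def)
qed

text \<open>
  Only the antisymmetric part of a perturbation is seen by \<open>\<xi> - \<eta>\<close>. A given difference mode \<open>v\<close> is
  therefore lifted with zero symmetric part, as \<open>\<xi> = v / 2\<close> and \<open>\<eta> = - v / 2\<close>.
\<close>

lemma difference_mode_solution_iff_linearized:
  "difference_mode_solution \<kappa> p v \<longleftrightarrow>
     (\<exists>\<xi> \<eta>. linearized_pendula_solution \<kappa> p p \<xi> \<eta> \<and> v = (\<lambda>t. \<xi> t - \<eta> t))"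
proof (intro iffI; (elim exE conjE)?)
  assume v: "difference_mode_solution \<kappa> p v"
  have "bounded_linear (\<lambda>z::real. (z / 2, - (z / 2)))"
    by (intro bounded_linear_Pair bounded_linear_minus bounded_linear_divide)
  then have "linearized_pendula_solution \<kappa> p p (\<lambda>t. v t / 2) (\<lambda>t. - (v t / 2))"
    using v unfolding linearized_pendula_solution_def difference_mode_solution_def
    by (rule solves_second_order_linear_image)
      (simp add: frechet_derivative_coupled_force field_simps)
  then show "\<exists>\<xi> \<eta>. linearized_pendula_solution \<kappa> p p \<xi> \<eta> \<and> v = (\<lambda>t. \<xi> t - \<eta> t)"
    by (intro exI[of _ "\<lambda>t. v t / 2"] exI[of _ "\<lambda>t. - (v t / 2)"]) simp
next
  fix \<xi> \<eta>
  assume lin: "linearized_pendula_solution \<kappa> p p \<xi> \<eta>" and v: "v = (\<lambda>t. \<xi> t - \<eta> t)"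
  have "bounded_linear (\<lambda>z::real \<times> real. fst z - snd z)"
    by (intro bounded_linear_sub bounded_linear_fst bounded_linear_snd)
  from solves_second_order_linear_image[OF this lin[unfolded linearized_pendula_solution_def],
      where g = "\<lambda>t z. - (2 * \<kappa> + cos (p t)) * z"]
  show "difference_mode_solution \<kappa> p v"
    by (simp add: v difference_mode_solution_def frechet_derivative_coupled_force algebra_simps)
qed

section \<open>Reduction to the Lame equation\<close>

theorem theorem4:
  fixes \<kappa> E k :: real and p w :: "real \<Rightarrow> real"
  assumes "E > 0"
    and "pendulum_solution p"
    and "p 0 = 0"
    and "\<forall>t. deriv p t > 0"
    and "\<forall>t. (deriv p t)\<^sup>2 / 2 - (1 + cos (p t)) = E"
    and "difference_mode_solution \<kappa> p w"
    and "k > 0"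
    and "k\<^sup>2 = 2 / (2 + E)"
  shows "coupled_pendula_solution \<kappa> p p \<and>
         (\<forall>v. difference_mode_solution \<kappa> p v \<longleftrightarrow>
            (\<exists>\<xi> \<eta>. linearized_pendula_solution \<kappa> p p \<xi> \<eta> \<and> v = (\<lambda>t. \<xi> t - \<eta> t))) \<and>
         lame_solution 1 ((2 * \<kappa> + 1) * k\<^sup>2) k (\<lambda>\<tau>. w (k * \<tau>))"
proof (intro conjI allI)
  show "coupled_pendula_solution \<kappa> p p"
    using assms(2) by (rule synchronous_coupled_pendula_solution)
  show "difference_mode_solution \<kappa> p v \<longleftrightarrow>
      (\<exists>\<xi> \<eta>. linearized_pendula_solution \<kappa> p p \<xi> \<eta> \<and> v = (\<lambda>t. \<xi> t - \<eta> t))" for v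
    by (rule difference_mode_solution_iff_linearized)
  have "(p has_real_derivative deriv p t) (at t)" for t
    using assms(2) unfolding pendulum_solution_def
    by (rule solves_second_order_imp_has_real_derivative)
  then have "jacobi_am \<tau> k = p (k * \<tau>) / 2" for \<tau>
    using assms by (intro jacobi_am_rotating_pendulum[where p' = "deriv p"]) auto
  then have "jacobi_sn \<tau> k = sin (p (k * \<tau>) / 2)" for \<tau>
    by (simp only: jacobi_sn_def)
  then have cos_p: "cos (p (k * \<tau>)) = 1 - 2 * (jacobi_sn \<tau> k)\<^sup>2" for \<tau>
    using cos_double_sin[of "p (k * \<tau>) / 2"] by simp
  show "lame_solution 1 ((2 * \<kappa> + 1) * k\<^sup>2) k (\<lambda>\<tau>. w (k * \<tau>))"
    unfolding lame_solution_def
    using solves_second_order_rescale[OF assms(6)[unfolded difference_mode_solution_def]]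
    by (rule solves_second_order_cong) (simp add: cos_p, simp add: algebra_simps)
qed

end
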